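(* Let $k,s\in\mathbb N^+$ and $1\le j\le i-1\le N$. Then the quantity $$t_{i,j}=(i-j-1)^{3-\alpha(x_i)}-2(i-j)^{3-\alpha(x_i)}+(i-j+1)^{3-\alpha(x_i)}$$ can be approximated by $$t_{i,j}\approx 2(i-j)^{3-\bar\alpha}\left[\sum_{p=0}^{s}\frac{(\bar\alpha-\alpha(x_i))^p}{p!}\ln^p(i-j)\right]\cdot\left[\sum_{q=1}^{k}\binom{3-\alpha(x_i)}{2q}\frac{1}{(i-j)^{2q}}\right],$$ and the residue $R^{i,j}_{s,k}$ (that is, $t_{i,j}$ minus the right-hand side) is given by $$R^{i,j}_{s,k}=(i-j)^{3-\bar\alpha}\,\hat R^{i,j}_{s+1}\left[\Big(1-\frac1{i-j}\Big)^{3-\alpha(x_i)}-2+\Big(1+\frac1{i-j}\Big)^{3-\alpha(x_i)}\right]+(i-j)^{3-\alpha(x_i)}R^{i,j}_{2k+2}-(i-j)^{3-\bar\alpha}\,\hat R^{i,j}_{s+1}R^{i,j}_{2k+2},$$ where $R^{i,j}_{2k+2}$ and $\hat R^{i,j}_{s+1}$ are the Taylor remainders defined in the context.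
   Context: $N\ge1$ is an integer, $h=1/(N+1)$, $x_i=ih$, indices $i,j$ range over $1,\dots,N+1$. The function $\alpha:[0,1]\to\mathbb R$ is twice continuously differentiable with minimum $\alpha_{min}$ and maximum $\alpha_{max}$ satisfying $1\le\alpha_{min}\le\alpha(x)\le\alpha_{max}<2$, and $\alpha\not\equiv\alpha_{min}$ if $\alpha_{min}=1$; $\bar\alpha:=(\alpha_{max}+\alpha_{min})/2$. For real $\beta$ and integer $m\ge0$, $\binom{\beta}{m}=\beta(\beta-1)\cdots(\beta-m+1)/m!$; $0^{\beta}=0$ for $\beta>0$; the $p=0$ term of the first sum is $1$. Taylor remainders: $R^{i,j}_{2k+2}:=R^{i,j,-}_{2k+2}+R^{i,j,+}_{2k+2}$, where $R^{i,j,\pm}_{2k+2}$ is the remainder of the Taylor expansion of $(1\pm\frac1{i-j})^{3-\alpha(x_i)}$, namely $$\Big(1\pm\frac1{i-j}\Big)^{3-\alpha(x_i)}=\sum_{m=0}^{2k+1}(\pm1)^m\binom{3-\alpha(x_i)}{m}\frac1{(i-j)^m}+R^{i,j,\pm}_{2k+2};$$ and $\hat R^{i,j}_{s+1}$ is the remainder of the Taylor expansion of the exponential function $(i-j)^{\bar\alpha-\alpha(x_i)}$, namely $$(i-j)^{\bar\alpha-\alpha(x_i)}=\sum_{p=0}^{s}\frac{(\bar\alpha-\alpha(x_i))^p}{p!}\ln^p(i-j)+\hat R^{i,j}_{s+1}.$$ *)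

theory Defs
  imports Complex_Main
begin

text \<open>Functions on \<open>[0,1]\<close> are total functions \<open>real \<Rightarrow> real\<close> of which only the values
  on \<open>{0..1}\<close> are used; derivatives are taken within the set, i.e. one-sided at the end points.\<close>

definition C2_on :: "(real \<Rightarrow> real) \<Rightarrow> real set \<Rightarrow> bool" where
  "C2_on f S \<longleftrightarrow> (\<exists>f' f''.
      (\<forall>x\<in>S. (f has_real_derivative f' x) (at x within S)) \<and>
      (\<forall>x\<in>S. (f' has_real_derivative f'' x) (at x within S)) \<and>
      continuous_on S f'')"

definition is_minimum_on :: "real \<Rightarrow> (real \<Rightarrow> real) \<Rightarrow> real set \<Rightarrow> bool" where
  "is_minimum_on m f S \<longleftrightarrow> m \<in> f ` S \<and> (\<forall>x\<in>S. m \<le> f x)"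

definition is_maximum_on :: "real \<Rightarrow> (real \<Rightarrow> real) \<Rightarrow> real set \<Rightarrow> bool" where
  "is_maximum_on M f S \<longleftrightarrow> M \<in> f ` S \<and> (\<forall>x\<in>S. f x \<le> M)"

definition mesh :: "nat \<Rightarrow> real" where
  "mesh N = 1 / (real N + 1)"

definition node :: "nat \<Rightarrow> nat \<Rightarrow> real" where
  "node N i = real i * mesh N"

text \<open>Differences of indices are formed in the reals. The convention \<open>0 powr \<beta> = 0\<close> is used
  for \<open>i - j = 1\<close>.\<close>

definition t_coeff :: "(real \<Rightarrow> real) \<Rightarrow> nat \<Rightarrow> nat \<Rightarrow> nat \<Rightarrow> real" where
  "t_coeff \<alpha> N i j =
     (real i - real j - 1) powr (3 - \<alpha> (node N i))
     - 2 * (real i - real j) powr (3 - \<alpha> (node N i))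
     + (real i - real j + 1) powr (3 - \<alpha> (node N i))"

text \<open>With \<open>n = 2 * k + 2\<close>, the next two are the remainders of the binomial expansions of
  \<open>(1 \<plusminus> 1/(i-j)) powr (3 - \<alpha> (node N i))\<close> after the terms of order \<open>0, \<dots>, 2 * k + 1\<close>.\<close>

definition binom_rem_minus :: "(real \<Rightarrow> real) \<Rightarrow> nat \<Rightarrow> nat \<Rightarrow> nat \<Rightarrow> nat \<Rightarrow> real" where
  "binom_rem_minus \<alpha> N n i j =
     (1 - 1 / (real i - real j)) powr (3 - \<alpha> (node N i))
     - (\<Sum>m<n. (-1) ^ m * ((3 - \<alpha> (node N i)) gchoose m) * (1 / (real i - real j) ^ m))"

definition binom_rem_plus :: "(real \<Rightarrow> real) \<Rightarrow> nat \<Rightarrow> nat \<Rightarrow> nat \<Rightarrow> nat \<Rightarrow> real" where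
  "binom_rem_plus \<alpha> N n i j =
     (1 + 1 / (real i - real j)) powr (3 - \<alpha> (node N i))
     - (\<Sum>m<n. ((3 - \<alpha> (node N i)) gchoose m) * (1 / (real i - real j) ^ m))"

definition binom_rem :: "(real \<Rightarrow> real) \<Rightarrow> nat \<Rightarrow> nat \<Rightarrow> nat \<Rightarrow> nat \<Rightarrow> real" where
  "binom_rem \<alpha> N n i j = binom_rem_minus \<alpha> N n i j + binom_rem_plus \<alpha> N n i j"

text \<open>In the following sums the term for \<open>p = 0\<close> is \<open>1\<close>, since \<open>0 ^ 0 = 1\<close>. The parameter
  \<open>ab\<close> stands for the mean order, and \<open>n = s + 1\<close> gives the remainder after the terms
  of order \<open>0, \<dots>, s\<close>.\<close>

definition exp_rem :: "(real \<Rightarrow> real) \<Rightarrow> real \<Rightarrow> nat \<Rightarrow> nat \<Rightarrow> nat \<Rightarrow> nat \<Rightarrow> real" where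
  "exp_rem \<alpha> ab N n i j =
     (real i - real j) powr (ab - \<alpha> (node N i))
     - (\<Sum>p<n. (ab - \<alpha> (node N i)) ^ p / fact p * ln (real i - real j) ^ p)"

definition t_approx ::
  "(real \<Rightarrow> real) \<Rightarrow> real \<Rightarrow> nat \<Rightarrow> nat \<Rightarrow> nat \<Rightarrow> nat \<Rightarrow> nat \<Rightarrow> real" where
  "t_approx \<alpha> ab N s k i j =
     2 * (real i - real j) powr (3 - ab)
     * (\<Sum>p=0..s. (ab - \<alpha> (node N i)) ^ p / fact p * ln (real i - real j) ^ p)
     * (\<Sum>q=1..k. ((3 - \<alpha> (node N i)) gchoose (2 * q)) * (1 / (real i - real j) ^ (2 * q)))"

definition t_residue ::
  "(real \<Rightarrow> real) \<Rightarrow> real \<Rightarrow> nat \<Rightarrow> nat \<Rightarrow> nat \<Rightarrow> nat \<Rightarrow> nat \<Rightarrow> real" where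
  "t_residue \<alpha> ab N s k i j = t_coeff \<alpha> N i j - t_approx \<alpha> ab N s k i j"

end

theory Submission
  imports Defs
begin

text \<open>Write \<open>d = i - j\<close>, \<open>a = \<alpha>(x_i)\<close>, and let \<open>S + E\<close> be the expansion of \<open>d powr (\<alpha>bar - a)\<close>. Factoring out \<open>d\<close>
  gives \<open>t = d powr (3 - a) * B\<close> with \<open>B = (1 - 1/d) powr (3 - a) - 2 + (1 + 1/d) powr (3 - a)\<close>. The odd
  terms of the two binomial expansions cancel, so \<open>B = 2 * Q + R\<close> with \<open>Q\<close> the even sum of the
  approximation. With \<open>A = d powr (3 - \<alpha>bar)\<close> one gets
  \<open>t - 2*A*S*Q = A*(S + E)*B - A*S*(B - R) = A*E*B + A*(S + E)*R - A*E*R\<close>.\<close>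

text \<open>Induction on \<open>k\<close> adds the indices \<open>2 * k + 2\<close> and
  \<open>2 * k + 3\<close>: the even term doubles, the odd one cancels.\<close>

lemma sum_alternating_add:
  fixes c :: "nat \<Rightarrow> 'a::comm_ring_1"
  shows "(\<Sum>m<2 * k + 2. (-1) ^ m * c m) + (\<Sum>m<2 * k + 2. c m)
    = 2 * c 0 + 2 * (\<Sum>q=1..k. c (2 * q))"
  by (induction k) (simp_all add: algebra_simps)

text \<open>The two terms of order 0 supply the \<open>- 2\<close>.\<close>

lemma binom_rem_even:
  "binom_rem \<alpha> N (2 * k + 2) i j =
    (1 - 1 / (real i - real j)) powr (3 - \<alpha> (node N i)) - 2
      + (1 + 1 / (real i - real j)) powr (3 - \<alpha> (node N i))
      - 2 * (\<Sum>q=1..k. ((3 - \<alpha> (node N i)) gchoose (2 * q)) * (1 / (real i - real j) ^ (2 * q)))"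
  using sum_alternating_add
    [of "\<lambda>m. ((3 - \<alpha> (node N i)) gchoose m) * (1 / (real i - real j) ^ m)" k]
  unfolding binom_rem_def binom_rem_minus_def binom_rem_plus_def
  by (simp add: mult.assoc del: sum.lessThan_Suc)

lemma t_coeff_factor:
  assumes "j < i"
  shows "t_coeff \<alpha> N i j = (real i - real j) powr (3 - \<alpha> (node N i))
    * ((1 - 1 / (real i - real j)) powr (3 - \<alpha> (node N i)) - 2
      + (1 + 1 / (real i - real j)) powr (3 - \<alpha> (node N i)))"
proof -
  define d b where "d = real i - real j" and "b = 3 - \<alpha> (node N i)"
  have d: "d \<ge> 1"
    using assms by (simp add: d_def)
  \<comment> \<open>Here \<open>1 - 1 / d\<close> is nonnegative; for \<open>d = 1\<close> both
    sides vanish because \<open>0 powr b = 0\<close>.\<close>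
  have "(d - 1) powr b = d powr b * (1 - 1 / d) powr b"
    using d by (subst powr_mult [symmetric]) (auto simp: right_diff_distrib distrib_left)
  moreover have "(d + 1) powr b = d powr b * (1 + 1 / d) powr b"
    using d by (subst powr_mult [symmetric]) (auto simp: right_diff_distrib distrib_left)
  ultimately show ?thesis
    unfolding t_coeff_def d_def [symmetric] b_def [symmetric] by (simp add: algebra_simps)
qed

theorem theorem2:
  fixes \<alpha> :: "real \<Rightarrow> real" and \<alpha>min \<alpha>max \<alpha>bar :: real
    and N k s i j :: nat
  assumes "N \<ge> 1"
    and "C2_on \<alpha> {0..1}"
    and "is_minimum_on \<alpha>min \<alpha> {0..1}"
    and "is_maximum_on \<alpha>max \<alpha> {0..1}"
    and "1 \<le> \<alpha>min" and "\<alpha>max < 2"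
    and "\<alpha>min = 1 \<longrightarrow> (\<exists>x\<in>{0..1}. \<alpha> x \<noteq> \<alpha>min)"
    and "\<alpha>bar = (\<alpha>max + \<alpha>min) / 2"
    and "k \<ge> 1" and "s \<ge> 1"
    and "1 \<le> j" and "j \<le> i - 1" and "i - 1 \<le> N"
  shows "t_residue \<alpha> \<alpha>bar N s k i j =
      (real i - real j) powr (3 - \<alpha>bar) * exp_rem \<alpha> \<alpha>bar N (s + 1) i j
        * ((1 - 1 / (real i - real j)) powr (3 - \<alpha> (node N i)) - 2
           + (1 + 1 / (real i - real j)) powr (3 - \<alpha> (node N i)))
      + (real i - real j) powr (3 - \<alpha> (node N i)) * binom_rem \<alpha> N (2 * k + 2) i j
      - (real i - real j) powr (3 - \<alpha>bar) * exp_rem \<alpha> \<alpha>bar N (s + 1) i j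
        * binom_rem \<alpha> N (2 * k + 2) i j"
proof -
  define d a where "d = real i - real j" and "a = \<alpha> (node N i)"
  define A where "A = d powr (3 - \<alpha>bar)"
  define B where "B = (1 - 1 / d) powr (3 - a) - 2 + (1 + 1 / d) powr (3 - a)"
  define S where "S = (\<Sum>p=0..s. (\<alpha>bar - a) ^ p / fact p * ln d ^ p)"
  define Q where "Q = (\<Sum>q=1..k. ((3 - a) gchoose (2 * q)) * (1 / d ^ (2 * q)))"
  define E where "E = exp_rem \<alpha> \<alpha>bar N (s + 1) i j"
  define R where "R = binom_rem \<alpha> N (2 * k + 2) i j"
  \<comment> \<open>Subtraction is truncated: \<open>j \<le> i - 1\<close> alone would admit
    \<open>i = j = 0\<close>, which \<open>1 \<le> j\<close> excludes.\<close>
  have "j < i"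
    using \<open>1 \<le> j\<close> \<open>j \<le> i - 1\<close> by linarith
  then have t: "t_coeff \<alpha> N i j = d powr (3 - a) * B"
    by (simp add: t_coeff_factor B_def d_def a_def)
  have E: "d powr (\<alpha>bar - a) = S + E"
    unfolding E_def exp_rem_def S_def d_def a_def
    by (simp add: atLeast0AtMost lessThan_Suc_atMost)
  have R: "R = B - 2 * Q"
    unfolding R_def binom_rem_even B_def Q_def d_def a_def by simp
  \<comment> \<open>The exponents \<open>3 - \<alpha>bar\<close> and \<open>\<alpha>bar - a\<close>
    add up to \<open>3 - a\<close>.\<close>
  have A: "d powr (3 - a) = A * (S + E)"
    unfolding A_def E [symmetric] by (simp flip: powr_add)
  have "t_residue \<alpha> \<alpha>bar N s k i j = d powr (3 - a) * B - 2 * A * S * Q"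
    unfolding t_residue_def t t_approx_def A_def S_def Q_def d_def a_def ..
  also have "\<dots> = A * E * B + d powr (3 - a) * R - A * E * R"
    unfolding A R by (simp add: algebra_simps)
  finally show ?thesis
    unfolding A_def B_def E_def R_def d_def a_def .
qed

end
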